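(* Let $(X_t:t\in T)$ be a family of topological spaces, $X=\prod_{t\in T}X_t$, $a=(a_t)_{t\in T}\in X$, let $(Y,d)$ be a metric space and let $f:(\sigma(a),\tau)\to Y$ be a strongly separately continuous mapping. Then the discontinuity point set $D(f)$ of $f$ is nearly open in $(\sigma(a),\tau)$.
   Context: $\sigma(a)$ is the set of all $y=(y_t)_{t\in T}\in X$ such that $\{t\in T:y_t\neq a_t\}$ is finite. $\tau$ denotes the Tychonoff product topology; $(\sigma(a),\tau)$ is $\sigma(a)$ with the subspace topology induced from $(X,\tau)$. For points $x,u\in X$ and $t\in T$, $x_t^u$ denotes the point obtained from $x$ by replacing its $t$-th coordinate by $u_t$. For a finite set $T_0\subseteq T$ and $z\in\prod_{t\in T_0}X_t$, $a_{T_0}^z$ denotes the point of $X$ whose $t$-th coordinate is $z_t$ if $t\in T_0$ and $a_t$ if $t\in T\setminus T_0$. A mapping $f:(\sigma(a),\tau)\to Y$ is strongly separately continuous if for every $u\in\sigma(a)$ and every $t\in T$ one has $\lim_{x\to u}d(f(x),f(x_t^u))=0$, the limit being taken over $x\in\sigma(a)$ in the topology $\tau$. $D(f)$ is the set of all points of $\sigma(a)$ at which $f$ is not continuous. A set $W\subseteq\sigma(a)$ is nearly open in $(\sigma(a),\tau)$ if for every finite set $T_0\subseteq T$ the set $W_{T_0}=\{z\in\prod_{t\in T_0}X_t:\ a_{T_0}^z\in W\}$ is open in $\prod_{t\in T_0}X_t$ with the product topology. *)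

theory Defs
  imports "HOL-Analysis.Analysis"
begin

text \<open>
  The family \<open>(X\<^sub>t : t \<in> T)\<close> is given by abstract topologies \<open>X t\<close> for \<open>t \<in> T\<close>, whose carriers
  \<open>topspace (X t)\<close> may be arbitrary subsets of the common type \<open>'a\<close>. Points of the product are
  functions in \<open>PiE T (topspace \<circ> X)\<close>, so they are \<open>undefined\<close> outside \<open>T\<close>.
\<close>

definition sigma_set :: "('t \<Rightarrow> 'a topology) \<Rightarrow> 't set \<Rightarrow> ('t \<Rightarrow> 'a) \<Rightarrow> ('t \<Rightarrow> 'a) set"
  where "sigma_set X T a =
    {y \<in> topspace (product_topology X T). finite {t \<in> T. y t \<noteq> a t}}"

definition sigma_topology :: "('t \<Rightarrow> 'a topology) \<Rightarrow> 't set \<Rightarrow> ('t \<Rightarrow> 'a) \<Rightarrow> ('t \<Rightarrow> 'a) topology"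
  where "sigma_topology X T a = subtopology (product_topology X T) (sigma_set X T a)"

text \<open>
  The point obtained from \<open>x\<close> by replacing its \<open>t\<close>-th coordinate by that of \<open>u\<close> is \<open>x(t := u t)\<close>.
  The filter \<^const>\<open>atin\<close> excludes \<open>u\<close> itself; this is immaterial when \<open>d\<close> is a metric, as the
  distance then vanishes at \<open>x = u\<close>.
\<close>

definition strongly_separately_continuous ::
  "('t \<Rightarrow> 'a topology) \<Rightarrow> 't set \<Rightarrow> ('t \<Rightarrow> 'a) \<Rightarrow> ('y \<Rightarrow> 'y \<Rightarrow> real) \<Rightarrow> (('t \<Rightarrow> 'a) \<Rightarrow> 'y) \<Rightarrow> bool"
  where "strongly_separately_continuous X T a d f \<longleftrightarrow>
    (\<forall>u \<in> sigma_set X T a. \<forall>t \<in> T.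
      ((\<lambda>x. d (f x) (f (x(t := u t)))) \<longlongrightarrow> 0) (atin (sigma_topology X T a) u))"

definition discontinuity_points :: "'a topology \<Rightarrow> 'b topology \<Rightarrow> ('a \<Rightarrow> 'b) \<Rightarrow> 'a set"
  where "discontinuity_points S Z f = {x \<in> topspace S. \<not> topcontinuous_at S Z f x}"

text \<open>
  For \<open>T\<^sub>0 \<subseteq> T\<close> and \<open>z\<close> in the product over \<open>T\<^sub>0\<close>, the point that agrees with \<open>z\<close> on \<open>T\<^sub>0\<close> and
  with \<open>a\<close> on \<open>T - T\<^sub>0\<close> is \<open>override_on a z T\<^sub>0\<close>.
\<close>

definition nearly_open ::
  "('t \<Rightarrow> 'a topology) \<Rightarrow> 't set \<Rightarrow> ('t \<Rightarrow> 'a) \<Rightarrow> ('t \<Rightarrow> 'a) set \<Rightarrow> bool"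
  where "nearly_open X T a W \<longleftrightarrow>
    W \<subseteq> sigma_set X T a \<and>
    (\<forall>T\<^sub>0. finite T\<^sub>0 \<and> T\<^sub>0 \<subseteq> T \<longrightarrow>
      openin (product_topology X T\<^sub>0)
        {z \<in> topspace (product_topology X T\<^sub>0). override_on a z T\<^sub>0 \<in> W})"

end

theory Submission
  imports Defs
begin

text \<open>
  Iterating strong separate continuity over a finite set \<open>T\<^sub>0\<close> of coordinates gives, for \<open>x\<close> in
  some box around \<open>u\<close>, that \<open>f x\<close> is close to \<open>f\<close> of the point obtained from \<open>x\<close> by replacing
  its \<open>T\<^sub>0\<close>-coordinates by those of \<open>u\<close>. So if \<open>v\<close> lies in that box and agrees with \<open>u\<close> off
  \<open>T\<^sub>0\<close>, then moving the \<open>T\<^sub>0\<close>-coordinates from \<open>u\<close> to \<open>v\<close> changes \<open>f\<close> little, and a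
  jump of \<open>f\<close> at \<open>u\<close> forces a jump of at least half the size at \<open>v\<close>.
\<close>

section \<open>Boxes in the product and in \<open>sigma_topology X T a\<close>\<close>

text \<open>The sides of a basic open set of the product topology. The family is kept instead of the
  set \<open>PiE T W\<close>, so that sides can be mixed coordinate by coordinate and restricted to
  a subset of \<open>T\<close>.\<close>

definition open_box :: "('t \<Rightarrow> 'a topology) \<Rightarrow> 't set \<Rightarrow> ('t \<Rightarrow> 'a set) \<Rightarrow> bool"
  where "open_box X T W \<longleftrightarrow>
    finite {i \<in> T. W i \<noteq> topspace (X i)} \<and> (\<forall>i \<in> T. openin (X i) (W i))"

lemma open_box_Int:
  assumes "open_box X T V" "open_box X T W"
  shows "open_box X T (\<lambda>i. V i \<inter> W i)"
proof -
  have "{i \<in> T. V i \<inter> W i \<noteq> topspace (X i)}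
      \<subseteq> {i \<in> T. V i \<noteq> topspace (X i)} \<union> {i \<in> T. W i \<noteq> topspace (X i)}"
    by auto
  moreover have "finite \<dots>"
    using assms by (simp add: open_box_def)
  ultimately have "finite {i \<in> T. V i \<inter> W i \<noteq> topspace (X i)}"
    by (rule finite_subset)
  then show ?thesis
    using assms by (simp add: open_box_def openin_Int)
qed

lemma open_box_override_on:
  assumes "open_box X T V" "open_box X T W"
  shows "open_box X T (override_on V W S)"
proof -
  have "{i \<in> T. override_on V W S i \<noteq> topspace (X i)}
      \<subseteq> {i \<in> T. V i \<noteq> topspace (X i)} \<union> {i \<in> T. W i \<noteq> topspace (X i)}"
    by (auto simp: override_on_def)
  moreover have "finite \<dots>"
    using assms by (simp add: open_box_def)
  ultimately have "finite {i \<in> T. override_on V W S i \<noteq> topspace (X i)}"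
    by (rule finite_subset)
  then show ?thesis
    using assms by (simp add: open_box_def override_on_def)
qed

text \<open>Two cases matter: \<open>S = T\<close> for the topology on \<sigma>(a), and finite
  \<open>S\<close> for the partial products in near openness.\<close>

lemma openin_PiE_open_box:
  assumes "open_box X T W" "S \<subseteq> T"
  shows "openin (product_topology X S) (PiE S W)"
proof -
  have "{i \<in> S. W i \<noteq> topspace (X i)} \<subseteq> {i \<in> T. W i \<noteq> topspace (X i)}"
    using assms by auto
  moreover have "finite \<dots>"
    using assms by (simp add: open_box_def)
  ultimately have "finite {i \<in> S. W i \<noteq> topspace (X i)}"
    by (rule finite_subset)
  then show ?thesis
    using assms by (auto simp: open_box_def openin_PiE_gen)
qed

lemma topspace_sigma_topology [simp]: "topspace (sigma_topology X T a) = sigma_set X T a"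
  by (auto simp: sigma_topology_def sigma_set_def)

lemma openin_sigma_topology_box:
  assumes "open_box X T W"
  shows "openin (sigma_topology X T a) (PiE T W \<inter> sigma_set X T a)"
  using openin_PiE_open_box[OF assms order_refl]
  by (auto simp: sigma_topology_def openin_subtopology)

lemma openin_sigma_topology_contains_box:
  assumes "openin (sigma_topology X T a) U" "u \<in> U"
  obtains W where "open_box X T W" "u \<in> PiE T W" "PiE T W \<inter> sigma_set X T a \<subseteq> U"
proof -
  obtain V where V: "openin (product_topology X T) V" "U = V \<inter> sigma_set X T a"
    using assms by (auto simp: sigma_topology_def openin_subtopology)
  then obtain W where "finite {i \<in> T. W i \<noteq> topspace (X i)}" "\<forall>i\<in>T. openin (X i) (W i)"
      "u \<in> PiE T W" "PiE T W \<subseteq> V"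
    using assms(2) unfolding openin_product_topology_alt by blast
  with V that[of W] show thesis
    by (auto simp: open_box_def)
qed

lemma override_on_in_PiE:
  assumes "x \<in> PiE T V" "u \<in> PiE T W"
  shows "override_on x u S \<in> PiE T (override_on V W S)"
  using assms by (auto simp: PiE_iff override_on_def extensional_def)

lemma override_on_in_sigma_set:
  assumes "x \<in> sigma_set X T a" "u \<in> sigma_set X T a"
  shows "override_on x u S \<in> sigma_set X T a"
proof -
  have "{t \<in> T. override_on x u S t \<noteq> a t} \<subseteq> {t \<in> T. x t \<noteq> a t} \<union> {t \<in> T. u t \<noteq> a t}"
    by (auto simp: override_on_def)
  moreover have "finite \<dots>"
    using assms by (simp add: sigma_set_def)
  ultimately have "finite {t \<in> T. override_on x u S t \<noteq> a t}"
    by (rule finite_subset)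
  then show ?thesis
    using assms by (simp add: sigma_set_def PiE_iff extensional_def override_on_def)
qed

section \<open>Strong separate continuity on boxes\<close>

lemma strongly_separately_continuous_box:
  assumes Y: "Metric_space Y d" and f: "f \<in> sigma_set X T a \<rightarrow> Y"
    and ssc: "strongly_separately_continuous X T a d f"
    and u: "u \<in> sigma_set X T a" and t: "t \<in> T" and e: "e > 0"
  obtains W where "open_box X T W" "u \<in> PiE T W"
    "\<And>x. x \<in> PiE T W \<inter> sigma_set X T a \<Longrightarrow> d (f x) (f (x(t := u t))) < e"
proof -
  interpret Metric_space Y d by (rule Y)
  have "eventually (\<lambda>x. dist (d (f x) (f (x(t := u t)))) 0 < e) (atin (sigma_topology X T a) u)"
    using ssc u t e by (intro tendstoD) (simp_all add: strongly_separately_continuous_def)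
  then obtain U where U: "openin (sigma_topology X T a) U" "u \<in> U"
      "\<And>x. x \<in> U - {u} \<Longrightarrow> d (f x) (f (x(t := u t))) < e"
    using u by (auto simp: eventually_atin)
  obtain W where W: "open_box X T W" "u \<in> PiE T W" "PiE T W \<inter> sigma_set X T a \<subseteq> U"
    using openin_sigma_topology_contains_box[OF U(1,2)] by metis
  \<comment> \<open>The punctured filter says nothing at \<open>x = u\<close>, but there both points
    coincide and the distance is 0.\<close>
  have "d (f u) (f (u(t := u t))) < e"
    using f u e by (auto simp: Pi_iff)
  then have "d (f x) (f (x(t := u t))) < e" if "x \<in> PiE T W \<inter> sigma_set X T a" for x
    using that U(3)[of x] W(3) by (cases "x = u") auto
  with W that show thesis by blast
qed

text \<open>Coordinates are replaced one at a time; each new one costs half of the allowed error,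
  the earlier ones share the other half.\<close>

lemma strongly_separately_continuous_override_on_box:
  assumes Y: "Metric_space Y d" and f: "f \<in> sigma_set X T a \<rightarrow> Y"
    and ssc: "strongly_separately_continuous X T a d f"
    and u: "u \<in> sigma_set X T a" and S: "finite S" "S \<subseteq> T" and e: "e > 0"
  shows "\<exists>W. open_box X T W \<and> u \<in> PiE T W \<and>
    (\<forall>x \<in> PiE T W \<inter> sigma_set X T a. d (f x) (f (override_on x u S)) < e)"
  using S e
proof (induction S arbitrary: e rule: finite_induct)
  case empty
  interpret Metric_space Y d by (rule Y)
  have "open_box X T (\<lambda>i. topspace (X i))"
    by (auto simp: open_box_def)
  moreover have "u \<in> PiE T (\<lambda>i. topspace (X i))"
    using u by (auto simp: sigma_set_def)
  moreover have "d (f x) (f (override_on x u {})) < e" if "x \<in> sigma_set X T a" for x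
    using that f empty by (auto simp: Pi_iff)
  ultimately show ?case by blast
next
  case (insert t S)
  interpret Metric_space Y d by (rule Y)
  obtain V where V: "open_box X T V" "u \<in> PiE T V"
      "\<And>x. x \<in> PiE T V \<inter> sigma_set X T a \<Longrightarrow> d (f x) (f (override_on x u S)) < e / 2"
    using insert.IH[of "e / 2"] insert.prems by auto
  obtain W where W: "open_box X T W" "u \<in> PiE T W"
      "\<And>x. x \<in> PiE T W \<inter> sigma_set X T a \<Longrightarrow> d (f x) (f (x(t := u t))) < e / 2"
    using strongly_separately_continuous_box[OF Y f ssc u, of t "e / 2"] insert.prems by auto
  have "d (f x) (f (override_on x u (insert t S))) < e"
    if x: "x \<in> PiE T (\<lambda>i. V i \<inter> W i)" "x \<in> sigma_set X T a" for x
  proof -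
    let ?y = "override_on x u S"
    have xV: "x \<in> PiE T V" and xW: "x \<in> PiE T W"
      using x by (auto simp: PiE_iff)
    \<comment> \<open>Since \<open>x\<close> and \<open>u\<close> both lie in the box of
      \<open>W\<close>, so does any mixture of their coordinates. Hence the estimate for the single
      coordinate \<open>t\<close> applies at \<open>?y\<close>.\<close>
    have y: "?y \<in> PiE T W" "?y \<in> sigma_set X T a"
      using override_on_in_PiE[OF xW W(2), of S] override_on_in_sigma_set[OF x(2) u, of S]
      by (auto simp: override_on_def PiE_iff)
    have z: "override_on x u (insert t S) = ?y(t := u t)"
      by (auto simp: override_on_def)
    have "override_on x u (insert t S) \<in> sigma_set X T a"
      by (rule override_on_in_sigma_set[OF x(2) u])
    then have "d (f x) (f (?y(t := u t))) \<le> d (f x) (f ?y) + d (f ?y) (f (?y(t := u t)))"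
      using f x y unfolding z by (intro triangle) (auto simp: Pi_iff)
    also have "\<dots> < e"
      using V(3)[of x] W(3)[of ?y] xV x y by simp
    finally show ?thesis by (simp only: z)
  qed
  moreover have "u \<in> PiE T (\<lambda>i. V i \<inter> W i)"
    using V W by (auto simp: PiE_iff)
  ultimately show ?case
    using open_box_Int[OF V(1) W(1)] by blast
qed

section \<open>Discontinuity as a jump, and its transfer to nearby points\<close>

text \<open>Traces of boxes form a neighbourhood base at \<open>u\<close> and balls one at
  \<open>f u\<close>; negating continuity in these terms yields one jump size \<open>e\<close> that
  serves all boxes.\<close>

lemma discontinuity_points_sigma_topology_iff:
  assumes Y: "Metric_space Y d" and f: "f \<in> sigma_set X T a \<rightarrow> Y"
    and u: "u \<in> sigma_set X T a"
  shows "u \<in> discontinuity_points (sigma_topology X T a) (Metric_space.mtopology Y d) f \<longleftrightarrow>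
    (\<exists>e>0. \<forall>W. open_box X T W \<and> u \<in> PiE T W \<longrightarrow>
      (\<exists>x \<in> PiE T W \<inter> sigma_set X T a. d (f u) (f x) \<ge> e))"
proof -
  interpret Metric_space Y d by (rule Y)
  have fY: "f x \<in> Y" if "x \<in> sigma_set X T a" for x
    using f that by auto
  have "topcontinuous_at (sigma_topology X T a) mtopology f u \<longleftrightarrow>
    (\<forall>e>0. \<exists>W. open_box X T W \<and> u \<in> PiE T W \<and>
      (\<forall>x \<in> PiE T W \<inter> sigma_set X T a. d (f u) (f x) < e))" (is "?L \<longleftrightarrow> ?R")
  proof
    assume L: ?L
    show ?R
    proof (intro allI impI)
      fix e :: real assume "e > 0"
      then have "openin mtopology (mball (f u) e)" "f u \<in> mball (f u) e"
        using fY[OF u] by auto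
      then obtain U where U: "openin (sigma_topology X T a) U" "u \<in> U" "\<forall>y\<in>U. f y \<in> mball (f u) e"
        using L unfolding topcontinuous_at_def by meson
      obtain W where "open_box X T W" "u \<in> PiE T W" "PiE T W \<inter> sigma_set X T a \<subseteq> U"
        using openin_sigma_topology_contains_box[OF U(1,2)] by metis
      then show "\<exists>W. open_box X T W \<and> u \<in> PiE T W \<and>
          (\<forall>x \<in> PiE T W \<inter> sigma_set X T a. d (f u) (f x) < e)"
        using U(3) by (intro exI[of _ W]) auto
    qed
  next
    assume R: ?R
    have "\<exists>U. openin (sigma_topology X T a) U \<and> u \<in> U \<and> (\<forall>y\<in>U. f y \<in> V)"
      if V: "openin mtopology V" "f u \<in> V" for V
    proof -
      obtain e where e: "e > 0" "mball (f u) e \<subseteq> V"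
        using V unfolding openin_mtopology by blast
      obtain W where W: "open_box X T W" "u \<in> PiE T W"
          "\<forall>x \<in> PiE T W \<inter> sigma_set X T a. d (f u) (f x) < e"
        using R e(1) by blast
      have "f y \<in> V" if "y \<in> PiE T W \<inter> sigma_set X T a" for y
      proof -
        have "f y \<in> mball (f u) e"
          using that W(3) fY u by simp
        then show ?thesis
          using e(2) by blast
      qed
      then show ?thesis
        using openin_sigma_topology_box[OF W(1)] W(2) u by blast
    qed
    then show ?L
      using u f by (auto simp: topcontinuous_at_def)
  qed
  then have "u \<in> discontinuity_points (sigma_topology X T a) mtopology f \<longleftrightarrow> \<not> ?R"
    using u by (simp add: discontinuity_points_def)
  also have "\<dots> \<longleftrightarrow> (\<exists>e>0. \<forall>W. open_box X T W \<and> u \<in> PiE T W \<longrightarrow>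
      (\<exists>x \<in> PiE T W \<inter> sigma_set X T a. d (f u) (f x) \<ge> e))"
    by (meson not_less)
  finally show ?thesis .
qed

text \<open>The condition \<open>override_on v u S = u\<close> says that \<open>v\<close> agrees
  with \<open>u\<close> off \<open>S\<close>. The box is chosen before \<open>v\<close>, so one box
  serves all such \<open>v\<close>.\<close>

lemma discontinuity_point_transfer:
  assumes Y: "Metric_space Y d" and f: "f \<in> sigma_set X T a \<rightarrow> Y"
    and ssc: "strongly_separately_continuous X T a d f"
    and S: "finite S" "S \<subseteq> T" and u: "u \<in> sigma_set X T a"
    and D: "u \<in> discontinuity_points (sigma_topology X T a) (Metric_space.mtopology Y d) f"
  obtains W where "open_box X T W" "u \<in> PiE T W"
    "\<And>v. v \<in> PiE T W \<inter> sigma_set X T a \<Longrightarrow> override_on v u S = u \<Longrightarrow>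
      v \<in> discontinuity_points (sigma_topology X T a) (Metric_space.mtopology Y d) f"
proof -
  interpret Metric_space Y d by (rule Y)
  note disc = discontinuity_points_sigma_topology_iff[OF Y f]
  have fY: "f x \<in> Y" if "x \<in> sigma_set X T a" for x
    using f that by auto
  obtain e where e: "e > 0" and jump: "\<And>W. open_box X T W \<Longrightarrow> u \<in> PiE T W \<Longrightarrow>
      \<exists>x \<in> PiE T W \<inter> sigma_set X T a. d (f u) (f x) \<ge> e"
    using D unfolding disc[OF u] by blast
  \<comment> \<open>Three errors below \<open>e / 8\<close> will be subtracted from the jump
    \<open>e\<close>, which leaves more than \<open>e / 2\<close>.\<close>
  have "e / 8 > 0" using e by simp
  then obtain W where W: "open_box X T W" "u \<in> PiE T W" and near:
      "\<And>x. x \<in> PiE T W \<Longrightarrow> x \<in> sigma_set X T a \<Longrightarrow> d (f x) (f (override_on x u S)) < e / 8"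
    using strongly_separately_continuous_override_on_box[OF Y f ssc u S] by (metis IntI)
  have "v \<in> discontinuity_points (sigma_topology X T a) mtopology f"
    if v: "v \<in> PiE T W" "v \<in> sigma_set X T a" and vu: "override_on v u S = u" for v
    unfolding disc[OF v(2)]
  proof (intro exI[of _ "e / 2"] conjI allI impI)
    fix V assume V: "open_box X T V \<and> v \<in> PiE T V"
    \<comment> \<open>Shrinking into \<open>W\<close> makes the estimate \<open>near\<close>
      available for the points found below.\<close>
    define V' where "V' = (\<lambda>i. V i \<inter> W i)"
    have V': "open_box X T V'" "v \<in> PiE T V'"
      using V W(1) v by (auto simp: V'_def open_box_Int PiE_iff)
    \<comment> \<open>On \<open>S\<close> the sides of \<open>V'\<close> may miss \<open>u\<close>,
      so they are replaced by those of \<open>W\<close>; off \<open>S\<close> they contain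
      \<open>u\<close>, which agrees there with \<open>v\<close>. The jump at \<open>u\<close> can
      then be used in this box.\<close>
    have "open_box X T (override_on V' W S)"
      by (intro open_box_override_on V' W)
    moreover have "u \<in> PiE T (override_on V' W S)"
      using override_on_in_PiE[OF V'(2) W(2), of S] by (simp only: vu)
    ultimately obtain x where x: "x \<in> PiE T (override_on V' W S)" "x \<in> sigma_set X T a"
        "d (f u) (f x) \<ge> e"
      using jump by blast
    \<comment> \<open>\<open>?y\<close> brings \<open>x\<close> back into the box around
      \<open>v\<close>. As \<open>x\<close> and \<open>?y\<close> differ only on \<open>S\<close>,
      writing \<open>u\<close> there turns both into \<open>?p\<close>, which allows
      \<open>f x\<close> and \<open>f ?y\<close> to be compared.\<close>
    let ?y = "override_on x v S"
    let ?p = "override_on x u S"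
    have y: "?y \<in> PiE T V'" "?y \<in> sigma_set X T a" and p: "?p \<in> sigma_set X T a"
      using override_on_in_PiE[OF x(1) V'(2), of S]
        override_on_in_sigma_set[OF x(2) v(2)] override_on_in_sigma_set[OF x(2) u]
      by (auto simp: override_on_def PiE_iff)
    have xW: "x \<in> PiE T W"
      using x(1) by (auto simp: V'_def override_on_def PiE_iff split: if_splits)
    have yVW: "?y \<in> PiE T V" "?y \<in> PiE T W"
      using y(1) by (auto simp: V'_def PiE_iff)
    have "override_on ?y u S = ?p"
      by (auto simp: override_on_def)
    then have "d (f ?y) (f ?p) < e / 8" "d (f x) (f ?p) < e / 8" "d (f v) (f u) < e / 8"
      using near[OF yVW(2) y(2)] near[OF xW x(2)] near[OF v] vu by simp_all
    \<comment> \<open>On the route \<open>f u\<close>, \<open>f v\<close>, \<open>f ?y\<close>,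
      \<open>f ?p\<close>, \<open>f x\<close>, every leg except that from \<open>f v\<close> to
      \<open>f ?y\<close> is shorter than \<open>e / 8\<close>.\<close>
    moreover have "d (f u) (f x) \<le> d (f u) (f v) + d (f v) (f x)"
      "d (f v) (f x) \<le> d (f v) (f ?y) + d (f ?y) (f x)"
      "d (f ?y) (f x) \<le> d (f ?y) (f ?p) + d (f ?p) (f x)"
      by (intro triangle fY u v x y p)+
    ultimately have "e / 2 \<le> d (f v) (f ?y)"
      using x(3) e by (simp add: commute[of "f u" "f v"] commute[of "f ?p" "f x"])
    then show "\<exists>x\<in>PiE T V \<inter> sigma_set X T a. e / 2 \<le> d (f v) (f x)"
      using yVW y(2) by blast
  qed (use e in simp)
  with W that show thesis by blast
qed

section \<open>Near openness of the discontinuity set\<close>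

theorem theorem4p1:
  fixes X :: "'t \<Rightarrow> 'a topology" and T :: "'t set" and a :: "'t \<Rightarrow> 'a"
    and Y :: "'y set" and d :: "'y \<Rightarrow> 'y \<Rightarrow> real" and f :: "('t \<Rightarrow> 'a) \<Rightarrow> 'y"
  assumes "a \<in> topspace (product_topology X T)"
    and "Metric_space Y d"
    and "f \<in> sigma_set X T a \<rightarrow> Y"
    and "strongly_separately_continuous X T a d f"
  shows "nearly_open X T a
    (discontinuity_points (sigma_topology X T a) (Metric_space.mtopology Y d) f)"
proof -
  let ?D = "discontinuity_points (sigma_topology X T a) (Metric_space.mtopology Y d) f"
  have D: "?D \<subseteq> sigma_set X T a"
    by (auto simp: discontinuity_points_def)
  have "openin (product_topology X S)
      {z \<in> topspace (product_topology X S). override_on a z S \<in> ?D}" (is "openin _ ?Z")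
    if S: "finite S" "S \<subseteq> T" for S
  proof (subst openin_subopen, intro ballI)
    fix z assume z: "z \<in> ?Z"
    let ?u = "override_on a z S"
    have u: "?u \<in> ?D" "?u \<in> sigma_set X T a"
      using z D by auto
    obtain W where W: "open_box X T W" "?u \<in> PiE T W" and disc:
      "\<And>v. v \<in> PiE T W \<inter> sigma_set X T a \<Longrightarrow> override_on v ?u S = ?u \<Longrightarrow> v \<in> ?D"
      using discontinuity_point_transfer[OF assms(2-4) S u(2,1)] by metis
    \<comment> \<open>The sides over \<open>S\<close> of the box at \<open>?u\<close> give the
      required neighbourhood of \<open>z\<close>.\<close>
    have "PiE S W \<subseteq> ?Z"
    proof
      fix w assume w: "w \<in> PiE S W"
      then have wtop: "w \<in> topspace (product_topology X S)"
        using openin_subset[OF openin_PiE_open_box[OF W(1) S(2)]] by blast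
      let ?v = "override_on a w S"
      have "{t \<in> T. ?v t \<noteq> a t} \<subseteq> S"
        by (auto simp: override_on_def)
      then have "finite {t \<in> T. ?v t \<noteq> a t}"
        using S(1) finite_subset by blast
      moreover have "?v \<in> topspace (product_topology X T)"
        using assms(1) wtop S(2) by (auto simp: PiE_iff override_on_def extensional_def)
      ultimately have "?v \<in> sigma_set X T a"
        by (simp add: sigma_set_def)
      \<comment> \<open>Off \<open>S\<close> both \<open>?v\<close> and \<open>?u\<close> have the
        coordinates of \<open>a\<close>, so membership there is inherited from \<open>?u\<close>; on
        \<open>S\<close> it comes from \<open>w\<close>.\<close>
      moreover have "?v i \<in> W i" if "i \<in> T" for i
        using that w PiE_mem[OF W(2) that] by (auto simp: override_on_def split: if_splits)
      then have "?v \<in> PiE T W"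
        using assms(1) S(2) by (auto simp: PiE_iff override_on_def extensional_def)
      moreover have "override_on ?v ?u S = ?u"
        by (auto simp: override_on_def)
      ultimately show "w \<in> ?Z"
        using disc wtop by blast
    qed
    moreover have "z \<in> PiE S W"
    proof (rule PiE_I)
      show "z i \<in> W i" if "i \<in> S" for i
        using PiE_mem[OF W(2), of i] that S(2) by (auto simp: override_on_def)
    qed (use z in \<open>auto simp: PiE_iff extensional_def\<close>)
    ultimately show "\<exists>U. openin (product_topology X S) U \<and> z \<in> U \<and> U \<subseteq> ?Z"
      using openin_PiE_open_box[OF W(1) S(2)] by blast
  qed
  with D show ?thesis
    by (auto simp: nearly_open_def)
qed

end
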